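(* Each diameter diminishing to zero iterated function system $\mathcal{S}=((X,d),(f_i)_{i\in I})$ is uniformly point fibred.
   Context: Metric spaces are nonempty. For a metric space $(X,d)$, $P_b(X)$ is the set of nonempty bounded subsets of $X$ and $P_{b,cl}(X)$ the set of nonempty bounded closed subsets. An iterated function system (IFS) is a pair $\mathcal{S}=((X,d),(f_i)_{i\in I})$ where $(X,d)$ is a complete metric space, $I$ is a nonempty finite set, each $f_i:X\to X$ is continuous, and $f_i(B)\in P_b(X)$ for every $B\in P_b(X)$ and $i\in I$. Its fractal operator $F_{\mathcal{S}}:P_{b,cl}(X)\to P_{b,cl}(X)$ is $F_{\mathcal{S}}(B)=\overline{\bigcup_{i\in I}f_i(B)}$. $\mathbb{N}^*=\{1,2,\dots\}$. $\Lambda(I)=I^{\mathbb{N}^*}$ is the set of infinite words $\omega=\omega_1\omega_2\dots$ over $I$; $\Lambda_n(I)$ is the set of words of length $n$ over $I$; $[\omega]_n=\omega_1\dots\omega_n$ for $\omega\in\Lambda(I)$; $f_\omega=f_{\omega_1}\circ\dots\circ f_{\omega_n}$ for $\omega=\omega_1\dots\omega_n\in\Lambda_n(I)$. An IFS $\mathcal{S}$ is diameter diminishing to zero if for every $B\in P_{b,cl}(X)$ there exists $M_B\in P_{b,cl}(X)$ such that $B\subseteq M_B$, $F_{\mathcal{S}}(M_B)\subseteq M_B$ and $\lim_{n\to\infty}\max_{\omega\in\Lambda_n(I)}\mathrm{diam}(f_\omega(M_B))=0$. An IFS $\mathcal{S}$ is point fibred if for every $\omega\in\Lambda(I)$ there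 exists $a_\omega\in X$ such that $\lim_{n\to\infty}f_{[\omega]_n}(x)=a_\omega$ for all $x\in X$. It is uniformly point fibred if it is point fibred and $\lim_{n\to\infty}\sup_{\omega\in\Lambda(I)}\sup_{x\in B}d(f_{[\omega]_n}(x),a_\omega)=0$ for every $B\in P_{b,cl}(X)$. *)

theory Defs
  imports "HOL-Analysis.Analysis" "HOL-Library.Stream"
begin

text \<open>
  The complete metric space \<open>X\<close> is a type of class \<^class>\<open>complete_space\<close>, and an IFS on it is
  given by a set of indices \<open>I\<close> and a family \<open>f\<close>, of which only the members \<open>f i\<close> with
  \<open>i \<in> I\<close> matter.
\<close>

definition P_b :: "'a::metric_space set set" where
  "P_b = {B. B \<noteq> {} \<and> bounded B}"

definition P_bcl :: "'a::metric_space set set" where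
  "P_bcl = {B. B \<noteq> {} \<and> bounded B \<and> closed B}"

definition IFS :: "'i set \<Rightarrow> ('i \<Rightarrow> 'a::complete_space \<Rightarrow> 'a) \<Rightarrow> bool" where
  "IFS I f \<longleftrightarrow> finite I \<and> I \<noteq> {} \<and>
     (\<forall>i\<in>I. continuous_on UNIV (f i)) \<and>
     (\<forall>i\<in>I. \<forall>B\<in>P_b. f i ` B \<in> P_b)"

definition fractal_operator :: "'i set \<Rightarrow> ('i \<Rightarrow> 'a::metric_space \<Rightarrow> 'a) \<Rightarrow> 'a set \<Rightarrow> 'a set" where
  "fractal_operator I f B = closure (\<Union>i\<in>I. f i ` B)"

text \<open>
  Infinite words over \<open>I\<close> are the elements of \<^term>\<open>streams I\<close>, and the prefix of length
  \<open>n\<close> of \<open>\<omega>\<close> is \<^term>\<open>stake n \<omega>\<close>.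
\<close>

definition words :: "nat \<Rightarrow> 'i set \<Rightarrow> 'i list set" where
  "words n I = {w. set w \<subseteq> I \<and> length w = n}"

text \<open>The first letter of a word is the outermost map: \<open>f\<^sub>w = f w\<^sub>1 \<circ> \<dots> \<circ> f w\<^sub>n\<close>.\<close>

fun word_map :: "('i \<Rightarrow> 'a \<Rightarrow> 'a) \<Rightarrow> 'i list \<Rightarrow> 'a \<Rightarrow> 'a" where
  "word_map f [] = id"
| "word_map f (i # w) = f i \<circ> word_map f w"

definition diameter_diminishing_to_zero ::
  "'i set \<Rightarrow> ('i \<Rightarrow> 'a::metric_space \<Rightarrow> 'a) \<Rightarrow> bool" where
  "diameter_diminishing_to_zero I f \<longleftrightarrow>
     (\<forall>B\<in>P_bcl. \<exists>M\<in>P_bcl. B \<subseteq> M \<and> fractal_operator I f M \<subseteq> M \<and>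
        (\<lambda>n. Max ((\<lambda>w. diameter (word_map f w ` M)) ` words n I)) \<longlonglongrightarrow> 0)"

definition point_fibred :: "'i set \<Rightarrow> ('i \<Rightarrow> 'a::metric_space \<Rightarrow> 'a) \<Rightarrow> bool" where
  "point_fibred I f \<longleftrightarrow>
     (\<forall>\<omega>\<in>streams I. \<exists>a. \<forall>x. (\<lambda>n. word_map f (stake n \<omega>) x) \<longlonglongrightarrow> a)"

text \<open>
  Below, \<open>a\<close> is the family of the points given by \<^const>\<open>point_fibred\<close>; on \<^term>\<open>streams I\<close> it is
  unique because limits are.  The suprema are taken in \<^typ>\<open>ennreal\<close>, so that they are genuine
  suprema even where the distances are not known to be bounded.
\<close>

definition uniformly_point_fibred :: "'i set \<Rightarrow> ('i \<Rightarrow> 'a::metric_space \<Rightarrow> 'a) \<Rightarrow> bool" where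
  "uniformly_point_fibred I f \<longleftrightarrow> point_fibred I f \<and>
     (\<exists>a. (\<forall>\<omega>\<in>streams I. \<forall>x. (\<lambda>n. word_map f (stake n \<omega>) x) \<longlonglongrightarrow> a \<omega>) \<and>
       (\<forall>B\<in>P_bcl.
         (\<lambda>n. SUP \<omega>\<in>streams I. SUP x\<in>B. ennreal (dist (word_map f (stake n \<omega>) x) (a \<omega>)))
           \<longlonglongrightarrow> 0))"

end

theory Submission
  imports Defs
begin

text \<open>
  Put a bounded set \<open>B\<close> into a bounded invariant set \<open>M\<close> such that the largest diameter \<open>D n\<close> of
  the pieces \<open>f\<^sub>w(M)\<close>, \<open>w\<close> a word of length \<open>n\<close>, tends to \<open>0\<close>. Appending letters to a word
  means composing on the inside, so invariance of \<open>M\<close> makes the pieces along the prefixes of an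
  infinite word \<open>\<omega>\<close> nested: writing \<open>g\<^sub>n\<close> for \<open>word_map f (stake n \<omega>)\<close>, the whole of
  \<open>g\<^sub>m(M)\<close> lies in \<open>g\<^sub>n(M)\<close> for \<open>n \<le> m\<close>. Hence \<open>g\<^sub>m(x)\<close> and \<open>g\<^sub>n(y)\<close> are at distance
  at most \<open>D n\<close>, with a bound that depends neither on \<open>\<omega>\<close> nor on \<open>x, y \<in> B\<close>
  (lemma \<open>uniform_prefix_dist_bound\<close>).

  Everything follows from this estimate. The orbit \<open>g\<^sub>m(x\<^sub>0)\<close> of one point is Cauchy, hence
  converges to some \<open>a \<omega>\<close>. Any bounded \<open>B\<close> may be enlarged by \<open>x\<^sub>0\<close>, and letting \<open>m\<close> tend to
  infinity in that orbit gives \<open>dist (g\<^sub>n(y)) (a \<omega>) \<le> D n\<close> for all \<open>y \<in> B\<close>, which is both the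
  independence of the starting point and the uniformity.
\<close>

lemma word_map_append: "word_map f (u @ v) x = word_map f u (word_map f v x)"
  by (induction u) auto

lemma word_map_mem_invariant:
  assumes "fractal_operator I f M \<subseteq> M" "set w \<subseteq> I" "x \<in> M"
  shows "word_map f w x \<in> M"
  using assms(2)
proof (induction w)
  case (Cons i w)
  then have "f i (word_map f w x) \<in> (\<Union>i\<in>I. f i ` M)"
    by auto
  then show ?case
    using assms(1) closure_subset[of "\<Union>i\<in>I. f i ` M"]
    by (auto simp: fractal_operator_def)
qed (simp add: assms)

lemma stake_in_words:
  assumes "\<omega> \<in> streams I"
  shows "stake n \<omega> \<in> words n I"
  using assms
proof (induction n arbitrary: \<omega>)
  case (Suc n)
  then show ?case
    using Suc.IH[OF streams_stl[OF Suc.prems]] streams_shd[OF Suc.prems] by (simp add: words_def)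
qed (simp add: words_def)

text \<open>
  Two starting points and two prefix lengths are compared at once, because both uses need it:
  \<open>x = y\<close> gives the Cauchy property of one orbit, and \<open>m \<longlongrightarrow> \<infinity>\<close> with \<open>n\<close> fixed
  compares an arbitrary orbit with the limit of another.
\<close>

lemma uniform_prefix_dist_bound:
  fixes f :: "'i \<Rightarrow> 'a::metric_space \<Rightarrow> 'a"
  assumes "finite I" "diameter_diminishing_to_zero I f" "B \<in> P_bcl"
  shows "\<exists>D :: nat \<Rightarrow> real. D \<longlonglongrightarrow> 0 \<and> (\<forall>\<omega>\<in>streams I. \<forall>x\<in>B. \<forall>y\<in>B. \<forall>n. \<forall>m\<ge>n.
      dist (word_map f (stake m \<omega>) x) (word_map f (stake n \<omega>) y) \<le> D n)"
proof -
  obtain M where M: "M \<in> P_bcl" "B \<subseteq> M" "fractal_operator I f M \<subseteq> M"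
    and lim: "(\<lambda>n. Max ((\<lambda>w. diameter (word_map f w ` M)) ` words n I)) \<longlonglongrightarrow> 0"
    using assms(2,3) unfolding diameter_diminishing_to_zero_def by blast
  show ?thesis
  proof (rule exI, rule conjI[OF lim], intro ballI allI impI)
    fix \<omega> x y and n m :: nat
    assume \<omega>: "\<omega> \<in> streams I" and xy: "x \<in> B" "y \<in> B" and "n \<le> m"
    let ?u = "stake n \<omega>" and ?v = "stake (m - n) (sdrop n \<omega>)"
    have u: "?u \<in> words n I"
      using \<omega> by (rule stake_in_words)
    have prefix: "stake m \<omega> = ?u @ ?v"
      using stake_add[of n \<omega> "m - n"] \<open>n \<le> m\<close> by (simp only: le_add_diff_inverse)
    have "set (stake m \<omega>) \<subseteq> I"
      using stake_in_words[OF \<omega>, of m] by (simp add: words_def)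
    then have v: "set ?v \<subseteq> I"
      unfolding prefix set_append by (rule Un_subset_iff[THEN iffD1, THEN conjunct2])
    have "word_map f (stake m \<omega>) x = word_map f ?u (word_map f ?v x)"
      unfolding prefix by (rule word_map_append)
    then have "word_map f (stake m \<omega>) x \<in> word_map f ?u ` M"
      using word_map_mem_invariant[OF M(3) v, of x] M(2) xy by blast
    moreover have "word_map f ?u y \<in> word_map f ?u ` M"
      using M(2) xy by blast
    moreover have "bounded (word_map f ?u ` M)"
    proof (rule bounded_subset)
      show "bounded M"
        using M(1) by (simp add: P_bcl_def)
      show "word_map f ?u ` M \<subseteq> M"
        using word_map_mem_invariant[OF M(3)] u by (auto simp: words_def)
    qed
    ultimately have "dist (word_map f (stake m \<omega>) x) (word_map f ?u y)
        \<le> diameter (word_map f ?u ` M)"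
      by (intro diameter_bounded_bound)
    also have "\<dots> \<le> Max ((\<lambda>w. diameter (word_map f w ` M)) ` words n I)"
      using u finite_lists_length_eq[OF assms(1), of n] by (intro Max_ge) (auto simp: words_def)
    finally show "dist (word_map f (stake m \<omega>) x) (word_map f ?u y)
        \<le> Max ((\<lambda>w. diameter (word_map f w ` M)) ` words n I)" .
  qed
qed

lemma convergent_prefix_orbit:
  fixes f :: "'i \<Rightarrow> 'a::complete_space \<Rightarrow> 'a"
  assumes "finite I" "diameter_diminishing_to_zero I f" "\<omega> \<in> streams I"
  shows "convergent (\<lambda>n. word_map f (stake n \<omega>) x)"
proof -
  have "{x} \<in> P_bcl"
    by (simp add: P_bcl_def)
  from uniform_prefix_dist_bound[OF assms(1,2) this]
  obtain D where D: "D \<longlonglongrightarrow> 0"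
    and bound: "\<forall>\<omega>\<in>streams I. \<forall>y\<in>{x}. \<forall>z\<in>{x}. \<forall>n. \<forall>m\<ge>n.
      dist (word_map f (stake m \<omega>) y) (word_map f (stake n \<omega>) z) \<le> D n"
    by (elim exE conjE)
  have le: "dist (word_map f (stake m \<omega>) x) (word_map f (stake n \<omega>) x) \<le> D n"
    if "n \<le> m" for n m
    using bound assms(3) that by simp
  have "Cauchy (\<lambda>n. word_map f (stake n \<omega>) x)"
    unfolding Cauchy_altdef2
  proof (intro allI impI)
    fix e :: real
    assume "e > 0"
    then obtain N where "D N < e"
      using order_tendstoD(2)[OF D] by (auto simp: eventually_sequentially)
    then show "\<exists>N. \<forall>n\<ge>N. dist (word_map f (stake n \<omega>) x) (word_map f (stake N \<omega>) x) < e"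
      using le by (meson le_less_trans)
  qed
  then show ?thesis
    by (rule Cauchy_convergent)
qed

theorem proposition3p2:
  fixes I :: "'i set" and f :: "'i \<Rightarrow> 'a::complete_space \<Rightarrow> 'a"
  assumes "IFS I f"
    and "diameter_diminishing_to_zero I f"
  shows "uniformly_point_fibred I f"
proof -
  have fin: "finite I"
    using assms(1) by (simp add: IFS_def)
  obtain x0 :: 'a where True by blast
  define a where "a \<omega> = lim (\<lambda>n. word_map f (stake n \<omega>) x0)" for \<omega>
  have lim0: "(\<lambda>n. word_map f (stake n \<omega>) x0) \<longlonglongrightarrow> a \<omega>" if "\<omega> \<in> streams I" for \<omega>
    using convergent_prefix_orbit[OF fin assms(2) that] by (simp add: a_def convergent_LIMSEQ_iff)
  have rate: "\<exists>D. D \<longlonglongrightarrow> 0 \<and> (\<forall>\<omega>\<in>streams I. \<forall>y\<in>B. \<forall>n.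
      dist (word_map f (stake n \<omega>) y) (a \<omega>) \<le> D n)" if "B \<in> P_bcl" for B
  proof -
    \<comment> \<open>Including \<open>x0\<close> makes the estimate compare every orbit from \<open>B\<close> with the one that defines \<open>a\<close>.\<close>
    have "insert x0 B \<in> P_bcl"
      using that by (simp add: P_bcl_def)
    from uniform_prefix_dist_bound[OF fin assms(2) this]
    obtain D where D: "D \<longlonglongrightarrow> 0"
      and bound: "\<forall>\<omega>\<in>streams I. \<forall>x\<in>insert x0 B. \<forall>y\<in>insert x0 B. \<forall>n. \<forall>m\<ge>n.
        dist (word_map f (stake m \<omega>) x) (word_map f (stake n \<omega>) y) \<le> D n"
      by (elim exE conjE)
    have le: "dist (word_map f (stake m \<omega>) x0) (word_map f (stake n \<omega>) y) \<le> D n"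
      if "\<omega> \<in> streams I" "y \<in> B" "n \<le> m" for \<omega> y n m
      using bound that by simp
    have "dist (word_map f (stake n \<omega>) y) (a \<omega>) \<le> D n"
      if "\<omega> \<in> streams I" "y \<in> B" for \<omega> y n
    proof (rule tendsto_upperbound)
      show "(\<lambda>m. dist (word_map f (stake n \<omega>) y) (word_map f (stake m \<omega>) x0))
          \<longlonglongrightarrow> dist (word_map f (stake n \<omega>) y) (a \<omega>)"
        by (intro tendsto_intros lim0 that)
      have "dist (word_map f (stake n \<omega>) y) (word_map f (stake m \<omega>) x0) \<le> D n"
        if "n \<le> m" for m
        using le[OF \<open>\<omega> \<in> streams I\<close> \<open>y \<in> B\<close> that]
        by (simp only: dist_commute)
      then show "\<forall>\<^sub>F m in sequentially.
          dist (word_map f (stake n \<omega>) y) (word_map f (stake m \<omega>) x0) \<le> D n"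
        by (rule eventually_sequentiallyI)
    qed simp
    with D show ?thesis by blast
  qed
  have lim: "(\<lambda>n. word_map f (stake n \<omega>) x) \<longlonglongrightarrow> a \<omega>" if "\<omega> \<in> streams I" for \<omega> x
  proof -
    have "{x} \<in> P_bcl"
      by (simp add: P_bcl_def)
    from rate[OF this] obtain D where D: "D \<longlonglongrightarrow> 0"
      and bound: "\<forall>\<omega>\<in>streams I. \<forall>y\<in>{x}. \<forall>n. dist (word_map f (stake n \<omega>) y) (a \<omega>) \<le> D n"
      by (elim exE conjE)
    have "dist (word_map f (stake n \<omega>) x) (a \<omega>) \<le> D n" for n
      using bound that by simp
    then show ?thesis
      unfolding tendsto_dist_iff[of _ "a \<omega>"]
      by (intro tendsto_sandwich[OF _ _ tendsto_const D] always_eventually) auto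
  qed
  have unif: "(\<lambda>n. SUP \<omega>\<in>streams I. SUP x\<in>B.
      ennreal (dist (word_map f (stake n \<omega>) x) (a \<omega>))) \<longlonglongrightarrow> 0" if "B \<in> P_bcl" for B
  proof -
    from rate[OF that] obtain D where D: "D \<longlonglongrightarrow> 0"
      and le: "\<forall>\<omega>\<in>streams I. \<forall>y\<in>B. \<forall>n. dist (word_map f (stake n \<omega>) y) (a \<omega>) \<le> D n"
      by (elim exE conjE)
    show ?thesis
    proof (rule tendsto_sandwich[OF always_eventually always_eventually tendsto_const])
      show "(\<lambda>n. ennreal (D n)) \<longlonglongrightarrow> 0"
        using tendsto_ennrealI[OF D] by simp
      show "\<forall>n. (SUP \<omega>\<in>streams I. SUP x\<in>B.
          ennreal (dist (word_map f (stake n \<omega>) x) (a \<omega>))) \<le> ennreal (D n)"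
        using le by (auto intro!: SUP_least ennreal_leI)
    qed simp
  qed
  have "point_fibred I f"
    unfolding point_fibred_def using lim by blast
  then show ?thesis
    unfolding uniformly_point_fibred_def using lim unif by blast
qed

end
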